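(* Let $M$ be an ordered $\Gamma$-groupoid and let $\mu : M \to [0,1]$ be a fuzzy subset of $M$. (i) If $\mu$ is a fuzzy right ideal of $M$ and $t\in[0,1]$ is such that $\mu_t \neq \emptyset$, then $\mu_t$ is a right ideal of $M$. (ii) Conversely, if $\mu_t$ is a right ideal of $M$ for every $t\in[0,1]$, then $\mu$ is a fuzzy right ideal of $M$.
   Context: Let $M,\Gamma$ be nonempty sets. $M$ is a $\Gamma$-groupoid if there is a well-defined operation $M\times\Gamma\times M\to M$, $(a,\gamma,b)\mapsto a\gamma b$ (no associativity assumed). An ordered $\Gamma$-groupoid is a $\Gamma$-groupoid $M$ with a partial order $\le$ on $M$ such that $a\le b$ implies $a\gamma c\le b\gamma c$ and $c\gamma a\le c\gamma b$ for all $c\in M$, $\gamma\in\Gamma$. A nonempty subset $A\subseteq M$ is a right ideal of $M$ if (1) $a\gamma x\in A$ for all $a\in A,\gamma\in\Gamma,x\in M$, and (2) $a\in A$, $b\in M$, $b\le a$ imply $b\in A$. (In particular right ideals are nonempty by definition.) A fuzzy subset of $M$ is any mapping $\mu:M\to[0,1]$. It is a fuzzy right ideal of $M$ if (1) $\mu(x\gamma y)\ge\mu(x)$ for all $x,y\in M$, $\gamma\in\Gamma$, and (2) $x\le y$ implies $\mu(x)\ge\mu(y)$. For $t\in[0,1]$, the level subset is $\mu_t:=\{x\in M\mid \mu(x)\ge t\}$. *)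

theory Defs
  imports Complex_Main "HOL-Library.FuncSet"
begin

text \<open>
  \<open>M\<close> and \<open>G\<close> (for \<open>\<Gamma>\<close>) are carrier sets, \<open>op a g b\<close> is the product \<open>a\<gamma>b\<close>, and the order on
  \<open>M\<close> is a relation \<open>r\<close>, with \<open>(a, b) \<in> r\<close> meaning \<open>a \<le> b\<close>. Values of the operation and of fuzzy
  subsets outside the carriers are never used.
\<close>

definition gamma_groupoid :: "'a set \<Rightarrow> 'g set \<Rightarrow> ('a \<Rightarrow> 'g \<Rightarrow> 'a \<Rightarrow> 'a) \<Rightarrow> bool" where
  "gamma_groupoid M G op \<longleftrightarrow>
     M \<noteq> {} \<and> G \<noteq> {} \<and> (\<forall>a\<in>M. \<forall>g\<in>G. \<forall>b\<in>M. op a g b \<in> M)"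

definition ordered_gamma_groupoid ::
    "'a set \<Rightarrow> 'g set \<Rightarrow> ('a \<Rightarrow> 'g \<Rightarrow> 'a \<Rightarrow> 'a) \<Rightarrow> 'a rel \<Rightarrow> bool" where
  "ordered_gamma_groupoid M G op r \<longleftrightarrow>
     gamma_groupoid M G op \<and> partial_order_on M r \<and>
     (\<forall>a\<in>M. \<forall>b\<in>M. (a, b) \<in> r \<longrightarrow>
        (\<forall>c\<in>M. \<forall>g\<in>G. (op a g c, op b g c) \<in> r \<and> (op c g a, op c g b) \<in> r))"

definition right_ideal ::
    "'a set \<Rightarrow> 'g set \<Rightarrow> ('a \<Rightarrow> 'g \<Rightarrow> 'a \<Rightarrow> 'a) \<Rightarrow> 'a rel \<Rightarrow> 'a set \<Rightarrow> bool" where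
  "right_ideal M G op r A \<longleftrightarrow>
     A \<noteq> {} \<and> A \<subseteq> M \<and>
     (\<forall>a\<in>A. \<forall>g\<in>G. \<forall>x\<in>M. op a g x \<in> A) \<and>
     (\<forall>a\<in>A. \<forall>b\<in>M. (b, a) \<in> r \<longrightarrow> b \<in> A)"

definition fuzzy_subset :: "'a set \<Rightarrow> ('a \<Rightarrow> real) \<Rightarrow> bool" where
  "fuzzy_subset M \<mu> \<longleftrightarrow> \<mu> \<in> M \<rightarrow> {0..1}"

definition fuzzy_right_ideal ::
    "'a set \<Rightarrow> 'g set \<Rightarrow> ('a \<Rightarrow> 'g \<Rightarrow> 'a \<Rightarrow> 'a) \<Rightarrow> 'a rel \<Rightarrow> ('a \<Rightarrow> real) \<Rightarrow> bool" where
  "fuzzy_right_ideal M G op r \<mu> \<longleftrightarrow>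
     fuzzy_subset M \<mu> \<and>
     (\<forall>x\<in>M. \<forall>g\<in>G. \<forall>y\<in>M. \<mu> (op x g y) \<ge> \<mu> x) \<and>
     (\<forall>x\<in>M. \<forall>y\<in>M. (x, y) \<in> r \<longrightarrow> \<mu> x \<ge> \<mu> y)"

definition level_subset :: "'a set \<Rightarrow> ('a \<Rightarrow> real) \<Rightarrow> real \<Rightarrow> 'a set" where
  "level_subset M \<mu> t = {x \<in> M. \<mu> x \<ge> t}"

end

theory Submission
  imports Defs
begin

text \<open>Both conditions on a fuzzy right ideal say that \<mu> does not decrease along certain
  moves: from \<open>x\<close> to a product \<open>op x g y\<close>, and from an element to one
  below it. A right ideal is a nonempty set closed under the same moves. If \<mu> never decreases
  along a move, every superlevel set is closed under it (\<open>right_ideal_level_subset\<close>).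
  Conversely, closure of the level at \<mu>'s value at the starting point says exactly that this
  value does not drop (\<open>fuzzy_right_ideal_if_level_subsets\<close>).\<close>

lemma right_ideal_level_subset:
  assumes "ordered_gamma_groupoid M G op r" "fuzzy_right_ideal M G op r \<mu>"
    and "level_subset M \<mu> t \<noteq> {}"
  shows "right_ideal M G op r (level_subset M \<mu> t)"
proof -
  \<comment> \<open>A level subset is cut out of the carrier, so the inequality on \<mu> must be
    paired with closure of \<open>M\<close> under the operation.\<close>
  have op: "op a g x \<in> M" if "a \<in> M" "g \<in> G" "x \<in> M" for a g x
    using assms(1) that by (simp add: ordered_gamma_groupoid_def gamma_groupoid_def)
  have mult: "\<mu> a \<le> \<mu> (op a g x)" if "a \<in> M" "g \<in> G" "x \<in> M" for a g x
    using assms(2) that by (simp add: fuzzy_right_ideal_def)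
  have anti: "\<mu> a \<le> \<mu> b" if "a \<in> M" "b \<in> M" "(b, a) \<in> r" for a b
    using assms(2) that unfolding fuzzy_right_ideal_def by blast
  have "op a g x \<in> level_subset M \<mu> t"
    if "a \<in> level_subset M \<mu> t" "g \<in> G" "x \<in> M" for a g x
    using that op[of a g x] mult[of a g x] by (simp add: level_subset_def)
  moreover have "b \<in> level_subset M \<mu> t"
    if "a \<in> level_subset M \<mu> t" "b \<in> M" "(b, a) \<in> r" for a b
    using that anti[of a b] by (simp add: level_subset_def)
  moreover have "level_subset M \<mu> t \<subseteq> M"
    by (auto simp: level_subset_def)
  ultimately show ?thesis
    using assms(3) unfolding right_ideal_def by blast
qed

text \<open>The values of \<mu> on \<open>M\<close> lie in the unit interval, so each may serve as
  the threshold \<open>t\<close> in \<open>ideal\<close>.\<close>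

lemma fuzzy_right_ideal_if_level_subsets:
  assumes \<mu>: "fuzzy_subset M \<mu>"
    and ideal: "\<And>t. t \<in> {0..1} \<Longrightarrow> right_ideal M G op r (level_subset M \<mu> t)"
  shows "fuzzy_right_ideal M G op r \<mu>"
proof -
  \<comment> \<open>Each \<open>x\<close> is tested against the level subset at its own value.\<close>
  have own_level: "right_ideal M G op r (level_subset M \<mu> (\<mu> x))" "x \<in> level_subset M \<mu> (\<mu> x)"
    if "x \<in> M" for x
    using that \<mu> ideal[of "\<mu> x"] by (auto simp: fuzzy_subset_def level_subset_def Pi_iff)
  have "\<mu> (op x g y) \<ge> \<mu> x" if "x \<in> M" "g \<in> G" "y \<in> M" for x g y
  proof -
    have "op x g y \<in> level_subset M \<mu> (\<mu> x)"
      using own_level[OF that(1)] that by (simp add: right_ideal_def)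
    then show ?thesis
      by (simp add: level_subset_def)
  qed
  moreover have "\<mu> x \<ge> \<mu> y" if "x \<in> M" "y \<in> M" "(x, y) \<in> r" for x y
  proof -
    \<comment> \<open>The threshold is the value at the larger element \<open>y\<close>: its level
      contains \<open>y\<close>, and downward closure then brings in \<open>x\<close>.\<close>
    have "x \<in> level_subset M \<mu> (\<mu> y)"
      using own_level[OF that(2)] that unfolding right_ideal_def by blast
    then show ?thesis
      by (simp add: level_subset_def)
  qed
  ultimately show ?thesis
    using \<mu> by (simp add: fuzzy_right_ideal_def)
qed

theorem theorem5:
  fixes M :: "'a set" and G :: "'g set"
    and op :: "'a \<Rightarrow> 'g \<Rightarrow> 'a \<Rightarrow> 'a" and r :: "'a rel"
    and \<mu> :: "'a \<Rightarrow> real"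
  assumes "ordered_gamma_groupoid M G op r"
    and "fuzzy_subset M \<mu>"
  shows "(fuzzy_right_ideal M G op r \<mu> \<longrightarrow>
           (\<forall>t\<in>{0..1}. level_subset M \<mu> t \<noteq> {} \<longrightarrow>
              right_ideal M G op r (level_subset M \<mu> t))) \<and>
         ((\<forall>t\<in>{0..1}. right_ideal M G op r (level_subset M \<mu> t)) \<longrightarrow>
           fuzzy_right_ideal M G op r \<mu>)"
proof (intro conjI impI ballI)
  fix t :: real
  assume "fuzzy_right_ideal M G op r \<mu>" "level_subset M \<mu> t \<noteq> {}"
  then show "right_ideal M G op r (level_subset M \<mu> t)"
    by (rule right_ideal_level_subset[OF assms(1)])
next
  assume "\<forall>t\<in>{0..1}. right_ideal M G op r (level_subset M \<mu> t)"
  then show "fuzzy_right_ideal M G op r \<mu>"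
    by (intro fuzzy_right_ideal_if_level_subsets[OF assms(2)]) (rule bspec)
qed

end
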